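(* Let $\mathsf n\ge1$ be an integer and $\rho\in(0,1)$. Consider $\mathsf n$ nodes operating under slotted ALOHA (SA) with per-slot activation probability $\rho$, and let $\xi_{\mathsf{sa}}=\rho(1-\rho)^{\mathsf n-1}$ and $\mathsf S_{\mathsf{sa}}=\mathsf n\rho(1-\rho)^{\mathsf n-1}$. Let $\delta^{(i)}_{\mathsf{sa}}(t)$ be the current age of information of node $i$, and define the average network age of information $$\Delta_{\mathsf{sa}}:=\frac1{\mathsf n}\sum_{i=1}^{\mathsf n}\lim_{t\to\infty}\frac1t\int_0^t\delta_{\mathsf{sa}}^{(i)}(\tau)\,d\tau.$$ For an integer threshold $\theta$, define the SA age-violation probability $\zeta_{\mathsf{sa}}(\theta):=\mathbb P\{\Psi>\theta-2\}$, where $\Psi$ is a random variable distributed according to the stationary distribution of the Markov chain $\Psi_k=\delta_{\mathsf{sa}}(k)-1$, $k\in\mathbb N_0$, for a given node. Then, with probability one (for the first identity, measured in slots), $$\Delta_{\mathsf{sa}}=\frac12+\frac{\mathsf n}{\mathsf S_{\mathsf{sa}}},\qquad \zeta_{\mathsf{sa}}(\theta)=\begin{cases}(1-\xi_{\mathsf{sa}})^{\theta-1}&\theta>1\\ 1&\text{otherwise.}\end{cases}$$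
   Context: Time is measured in slots of unit duration. There are $\mathsf n$ nodes sharing a channel to a common sink. At each slot every node, independently over nodes and slots, becomes active with probability $\rho$ and generates an update time-stamped with the start of that slot. Under slotted ALOHA the update is transmitted in the very slot in which it is generated. It is received if and only if no other node transmits in that slot, and there are no retransmissions. Hence a given node delivers an update in a slot with probability $\xi_{\mathsf{sa}}=\rho(1-\rho)^{\mathsf n-1}$, independently over slots. $\mathsf S_{\mathsf{sa}}$ is the aggregate throughput, i.e. the average number of packets decoded per slot. The current age of information of node $i$ is $\delta^{(i)}_{\mathsf{sa}}(t)=t-\sigma^{(i)}(t)$, where $\sigma^{(i)}(t)$ is the time-stamp of the last update received from node $i$ by time $t$. Within a slot the age grows linearly with slope 1: $\delta_{\mathsf{sa}}(t)=\delta_{\mathsf{sa}}(k)+(t-k)$ for $t\in[k,k+1)$. At the end of a slot in which the node delivers an update the age is reset to $1$; otherwise it is not reset. Time $t=0$ is set right after the reception of the first update. Thus $\Psi_k=\delta_{\mathsf{sa}}(k)-1$ is a Markov chain on $\mathbb N_0$ which from any state $j$ moves to $0$ with probability $\xi_{\mathsf{sa}}$ and to $j+1$ with probability $1-\xi_{\mathsf{sa}}$. *)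

theory Defs
  imports "HOL-Probability.Probability"
begin

text \<open>
  \<open>act i k \<omega>\<close> says that node \<open>i\<close> (one of \<open>1, \<dots>, n\<close>) is active in slot \<open>k\<close>, i.e. in the time
  interval \<open>[k, k + 1)\<close> of a clock that runs from the start of operation.
\<close>

definition delivers :: "nat \<Rightarrow> (nat \<Rightarrow> nat \<Rightarrow> 'a \<Rightarrow> bool) \<Rightarrow> nat \<Rightarrow> nat \<Rightarrow> 'a \<Rightarrow> bool" where
  "delivers n act i k \<omega> \<longleftrightarrow> act i k \<omega> \<and> (\<forall>j\<in>{1..n}. j \<noteq> i \<longrightarrow> \<not> act j k \<omega>)"

text \<open>
  The time axis of node \<open>i\<close> starts right after the reception of its first update: an update sent
  in slot \<open>k\<close> carries the time-stamp \<open>k\<close> and is received at time \<open>k + 1\<close>.  The \<open>LEAST\<close> is arbitrary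
  on the null event that the node never delivers anything.
\<close>

definition time_origin :: "nat \<Rightarrow> (nat \<Rightarrow> nat \<Rightarrow> 'a \<Rightarrow> bool) \<Rightarrow> nat \<Rightarrow> 'a \<Rightarrow> real" where
  "time_origin n act i \<omega> = real (LEAST k. delivers n act i k \<omega>) + 1"

text \<open>
  Time-stamps and reception times below are relative to \<open>time_origin\<close>.  For \<open>t \<ge> 0\<close> the set
  contains the stamp \<open>-1\<close> of the first update, so it is nonempty (and finite) almost surely.
\<close>

definition last_stamp :: "nat \<Rightarrow> (nat \<Rightarrow> nat \<Rightarrow> 'a \<Rightarrow> bool) \<Rightarrow> nat \<Rightarrow> 'a \<Rightarrow> real \<Rightarrow> real" where
  "last_stamp n act i \<omega> t =
     Max {real k - time_origin n act i \<omega> | k.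
            delivers n act i k \<omega> \<and> real k + 1 - time_origin n act i \<omega> \<le> t}"

definition age :: "nat \<Rightarrow> (nat \<Rightarrow> nat \<Rightarrow> 'a \<Rightarrow> bool) \<Rightarrow> nat \<Rightarrow> 'a \<Rightarrow> real \<Rightarrow> real" where
  "age n act i \<omega> t = t - last_stamp n act i \<omega> t"

definition time_avg_age :: "nat \<Rightarrow> (nat \<Rightarrow> nat \<Rightarrow> 'a \<Rightarrow> bool) \<Rightarrow> nat \<Rightarrow> 'a \<Rightarrow> real \<Rightarrow> real" where
  "time_avg_age n act i \<omega> t = 1 / t * integral {0..t} (age n act i \<omega>)"

definition network_age :: "nat \<Rightarrow> (nat \<Rightarrow> nat \<Rightarrow> 'a \<Rightarrow> bool) \<Rightarrow> 'a \<Rightarrow> real" where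
  "network_age n act \<omega> = 1 / real n * (\<Sum>i=1..n. Lim at_top (time_avg_age n act i \<omega>))"

definition xi_sa :: "nat \<Rightarrow> real \<Rightarrow> real" where
  "xi_sa n \<rho> = \<rho> * (1 - \<rho>) ^ (n - 1)"

definition throughput_sa :: "nat \<Rightarrow> real \<Rightarrow> real" where
  "throughput_sa n \<rho> = real n * \<rho> * (1 - \<rho>) ^ (n - 1)"

text \<open>
  Almost surely the age at an integer time is a positive integer, so \<open>nat \<lfloor>_\<rfloor>\<close> is only a change of type.
\<close>

definition age_chain :: "nat \<Rightarrow> (nat \<Rightarrow> nat \<Rightarrow> 'a \<Rightarrow> bool) \<Rightarrow> nat \<Rightarrow> nat \<Rightarrow> 'a \<Rightarrow> nat" where
  "age_chain n act i k \<omega> = nat \<lfloor>age n act i \<omega> (real k) - 1\<rfloor>"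

text \<open>Time-homogeneous Markov chain on a countable state space with transition kernel \<open>K\<close>.\<close>

definition markov_chain ::
  "'a measure \<Rightarrow> (nat \<Rightarrow> 'a \<Rightarrow> 's::countable) \<Rightarrow> ('s \<Rightarrow> 's pmf) \<Rightarrow> bool" where
  "markov_chain M X K \<longleftrightarrow>
     (\<forall>k. X k \<in> measurable M (count_space UNIV)) \<and>
     (\<forall>k x. \<P>(\<omega> in M. \<forall>j\<le>k. X j \<omega> = x j) \<noteq> 0 \<longrightarrow>
        \<P>(\<omega> in M. X (Suc k) \<omega> = x (Suc k) \<bar> \<forall>j\<le>k. X j \<omega> = x j) = pmf (K (x k)) (x (Suc k)))"

text \<open>
  The kernel is read off from the process.  This determines it at every state the process visits
  with positive probability, which for \<open>age_chain\<close> is every natural number.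
\<close>

definition stationary_distribution ::
  "'a measure \<Rightarrow> (nat \<Rightarrow> 'a \<Rightarrow> 's::countable) \<Rightarrow> 's pmf \<Rightarrow> bool" where
  "stationary_distribution M X \<pi> \<longleftrightarrow> (\<exists>K. markov_chain M X K \<and> bind_pmf \<pi> K = \<pi>)"

definition age_violation_prob ::
  "'a measure \<Rightarrow> nat \<Rightarrow> (nat \<Rightarrow> nat \<Rightarrow> 'a \<Rightarrow> bool) \<Rightarrow> nat \<Rightarrow> int \<Rightarrow> real" where
  "age_violation_prob M n act i \<theta> =
     measure_pmf.prob (THE \<pi>. stationary_distribution M (age_chain n act i) \<pi>)
       {\<psi>. int \<psi> > \<theta> - 2}"

end

theory Submission
  imports Defs
begin

text \<open>
  Successful deliveries of a node form a Bernoulli process with success probability \<open>p = xi_sa n \<rho>\<close>,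
  and the age at the end of a slot exceeds the number of slots \<open>G\<close> since the last delivery by \<open>1\<close>.
  The compensator of \<open>G\<close> makes \<open>p \<Sum> G\<^sub>k + G\<^sub>N - N (1 - p)\<close> a martingale with orthogonal increments of bounded
  variance, so its square has mean \<open>O(N)\<close>; divided by \<open>N\<^sup>2\<close>, these means are summable along \<open>N = m\<^sup>2\<close>, and
  monotonicity of \<open>\<Sum> G\<^sub>k\<close> fills the gaps between the squares.  Hence \<open>G\<close> averages to \<open>(1 - p) / p\<close>, and
  each slot adds \<open>3 / 2\<close> more to the integral of the age.

  For the chain, a delivery in the next slot is independent of the past even after the random time shift,
  and the fixed-point equation of the kernel \<open>j \<mapsto> 0\<close> or \<open>j \<mapsto> j + 1\<close> is the recursion of the geometric distribution.
\<close>

section \<open>Sample paths\<close>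

text \<open>Counts the slots since the last success, with slot 0 treated as a success whatever
  \<open>d 0\<close> is. From the first true success on, this convention has no effect.\<close>

fun gap :: "(nat \<Rightarrow> bool) \<Rightarrow> nat \<Rightarrow> nat" where
  "gap d 0 = 0"
| "gap d (Suc m) = (if d (Suc m) then 0 else Suc (gap d m))"

lemma gap_le: "gap d m \<le> m"
  by (induction m) auto

lemma gap_cong: "(\<And>k. k \<le> m \<Longrightarrow> d k = d' k) \<Longrightarrow> gap d m = gap d' m"
  by (induction m) auto

text \<open>In each slot the latest success either moves to that slot or stays, and then the gap
  absorbs the extra slot. This identifies the maximum in \<open>last_stamp\<close>.\<close>

lemma gap_last_success:
  assumes "d T" "T \<le> m"
  shows "d (m - gap d m)" "T \<le> m - gap d m" "\<And>k. d k \<Longrightarrow> k \<le> m \<Longrightarrow> k \<le> m - gap d m"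
proof -
  have "d (m - gap d m) \<and> T \<le> m - gap d m \<and> (\<forall>k. d k \<longrightarrow> k \<le> m \<longrightarrow> k \<le> m - gap d m)"
    using assms(2)
  proof (induction m rule: dec_induct)
    case base
    \<comment> \<open>For \<open>T = 0\<close> this is the convention at slot 0, otherwise the reset
      at a success.\<close>
    have "gap d T = 0"
      using assms(1) by (cases T) auto
    then show ?case
      using assms(1) by simp
  next
    case (step m)
    then show ?case
      by (auto simp: le_Suc_eq)
  qed
  then show "d (m - gap d m)" "T \<le> m - gap d m" "\<And>k. d k \<Longrightarrow> k \<le> m \<Longrightarrow> k \<le> m - gap d m"
    by auto
qed

lemma gap_no_success: "(\<And>k. 0 < k \<Longrightarrow> k \<le> m \<Longrightarrow> \<not> d k) \<Longrightarrow> gap d m = m"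
  by (induction m) auto

text \<open>
  Slot \<open>T + k\<close> on the clock of \<^const>\<open>delivers\<close> ends at time \<open>k\<close> on the clock of
  \<^const>\<open>age\<close>.
\<close>

lemma age_eq:
  fixes n i :: nat and act :: "nat \<Rightarrow> nat \<Rightarrow> 'a \<Rightarrow> bool" and \<omega> :: 'a
  defines "d \<equiv> \<lambda>k. delivers n act i k \<omega>"
  defines "T \<equiv> LEAST k. d k"
  assumes ex: "\<exists>k. d k" and t: "t \<ge> 0"
  shows "age n act i \<omega> t = t - real (nat \<lfloor>t\<rfloor>) + (real (gap d (T + nat \<lfloor>t\<rfloor>)) + 1)"
proof -
  define N where "N = nat \<lfloor>t\<rfloor>"
  have dT: "d T"
    unfolding T_def using ex by (auto intro: LeastI)
  note L = gap_last_success[where d = d and T = T and m = "T + N", OF dT le_add1]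
  \<comment> \<open>An update of slot \<open>k\<close> arrives at \<open>k + 1\<close>, and the
    origin \<open>T + 1\<close> is itself an arrival time, so the two units cancel.\<close>
  have le_iff: "real k + 1 - (real T + 1) \<le> t \<longleftrightarrow> k \<le> T + N" for k
    using t unfolding N_def by (auto simp: le_nat_iff) linarith+
  have "last_stamp n act i \<omega> t = Max {real k - (real T + 1) | k. d k \<and> k \<le> T + N}"
    using le_iff unfolding last_stamp_def time_origin_def T_def d_def by simp
  also have "\<dots> = real (T + N - gap d (T + N)) - (real T + 1)"
  proof (rule Max_eqI)
    have "{real k - (real T + 1) | k. d k \<and> k \<le> T + N} \<subseteq> (\<lambda>k. real k - (real T + 1)) ` {..T + N}"
      by auto
    then show "finite {real k - (real T + 1) | k. d k \<and> k \<le> T + N}"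
      by (rule finite_subset) simp
  next
    fix y assume "y \<in> {real k - (real T + 1) | k. d k \<and> k \<le> T + N}"
    then show "y \<le> real (T + N - gap d (T + N)) - (real T + 1)"
      using L(3) by (auto simp del: of_nat_diff)
  next
    show "real (T + N - gap d (T + N)) - (real T + 1) \<in> {real k - (real T + 1) | k. d k \<and> k \<le> T + N}"
      using L(1) by (intro CollectI exI[of _ "T + N - gap d (T + N)"]) auto
  qed
  finally show ?thesis
    using gap_le[of d "T + N"] unfolding age_def N_def by (simp add: of_nat_diff)
qed

lemma age_chain_eq:
  fixes n i :: nat and act :: "nat \<Rightarrow> nat \<Rightarrow> 'a \<Rightarrow> bool" and \<omega> :: 'a
  defines "d \<equiv> \<lambda>k. delivers n act i k \<omega>"
  assumes "\<exists>k. d k"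
  shows "age_chain n act i k \<omega> = gap d ((LEAST k. d k) + k)"
  using age_eq[of n act i \<omega> "real k"] assms unfolding age_chain_def d_def by simp

section \<open>Time averages\<close>

text \<open>Each unit interval carries a tooth of slope 1 on a base of height \<open>c k\<close>: a
  rectangle plus a triangle of area \<open>1 / 2\<close>.\<close>

lemma sawtooth_has_integral:
  fixes f :: "real \<Rightarrow> real"
  assumes f: "\<And>t. t \<ge> 0 \<Longrightarrow> f t = t - real (nat \<lfloor>t\<rfloor>) + c (nat \<lfloor>t\<rfloor>)"
  shows "(f has_integral (\<Sum>k<N. c k + 1 / 2)) {0..real N}"
proof (induction N)
  case 0
  show ?case using has_integral_refl(2)[of f 0] by simp
next
  case (Suc N)
  have "((\<lambda>t. t - real N + c N) has_integral
      (((real (Suc N))\<^sup>2 / 2 - real N * real (Suc N) + c N * real (Suc N)) -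
       ((real N)\<^sup>2 / 2 - real N * real N + c N * real N))) {real N..real (Suc N)}"
    by (intro fundamental_theorem_of_calculus)
       (auto intro!: derivative_eq_intros simp flip: has_real_derivative_iff_has_vector_derivative)
  also have "((real (Suc N))\<^sup>2 / 2 - real N * real (Suc N) + c N * real (Suc N)) -
       ((real N)\<^sup>2 / 2 - real N * real N + c N * real N) = c N + 1 / 2"
    by (simp add: power2_eq_square field_simps)
  finally have *: "((\<lambda>t. t - real N + c N) has_integral (c N + 1 / 2)) {real N..real (Suc N)}" .
  have "(f has_integral (c N + 1 / 2)) {real N..real (Suc N)}"
  \<comment> \<open>At the right endpoint \<open>f\<close> already belongs to the next tooth; a
    single point does not change the integral.\<close>
  proof (rule has_integral_spike_finite[OF _ _ *])
    show "finite {real (Suc N)}"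
      by simp
    fix t assume "t \<in> {real N..real (Suc N)} - {real (Suc N)}"
    then have "\<lfloor>t\<rfloor> = int N" "t \<ge> 0"
      by (auto simp: floor_eq_iff)
    then show "f t = t - real N + c N"
      using f by simp
  qed
  then show ?case
    using has_integral_combine[OF _ _ Suc.IH] by simp
qed

text \<open>
  For a monotone function, the average along the squares determines the average at all times,
  because consecutive squares have ratio tending to \<open>1\<close>.
\<close>

lemma tendsto_average_if_squares:
  fixes F :: "real \<Rightarrow> real"
  assumes mono: "\<And>s t. 0 \<le> s \<Longrightarrow> s \<le> t \<Longrightarrow> F s \<le> F t" and F0: "F 0 \<ge> 0"
    and lim: "(\<lambda>m. F (real (m\<^sup>2)) / real (m\<^sup>2)) \<longlonglongrightarrow> L"
  shows "((\<lambda>t. F t / t) \<longlongrightarrow> L) at_top"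
proof -
  define a where "a m = F (real (m\<^sup>2)) / real (m\<^sup>2)" for m :: nat
  have a: "a \<longlonglongrightarrow> L"
    using lim unfolding a_def .
  \<comment> \<open>\<open>q t\<close> is the root of the largest square not exceeding
    \<open>t\<close>.\<close>
  define q where "q t = nat \<lfloor>sqrt t\<rfloor>" for t :: real
  have q: "filterlim q at_top at_top"
    unfolding q_def
    by (intro filterlim_compose[OF filterlim_nat_sequentially]
        filterlim_compose[OF filterlim_floor_sequentially] sqrt_at_top)
  have r: "(\<lambda>m. (real m / real (Suc m))\<^sup>2) \<longlonglongrightarrow> 1"
    using tendsto_power[OF LIMSEQ_n_over_Suc_n[where 'a = real], of 2] by simp
  have r': "(\<lambda>m. (real (Suc m) / real m)\<^sup>2) \<longlonglongrightarrow> 1"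
    using tendsto_power[OF LIMSEQ_Suc_n_over_n[where 'a = real], of 2] by simp
  have "(\<lambda>m. a m * (real m / real (Suc m))\<^sup>2) \<longlonglongrightarrow> L * 1"
    by (intro tendsto_mult a r)
  then have lower: "((\<lambda>t. a (q t) * (real (q t) / real (Suc (q t)))\<^sup>2) \<longlongrightarrow> L) at_top"
    using filterlim_compose[OF _ q] by simp
  have "(\<lambda>m. a (Suc m) * (real (Suc m) / real m)\<^sup>2) \<longlonglongrightarrow> L * 1"
    by (intro tendsto_mult LIMSEQ_Suc a r')
  then have upper: "((\<lambda>t. a (Suc (q t)) * (real (Suc (q t)) / real (q t))\<^sup>2) \<longlongrightarrow> L) at_top"
    using filterlim_compose[OF _ q] by simp
  have ev: "\<forall>\<^sub>F t in at_top. a (q t) * (real (q t) / real (Suc (q t)))\<^sup>2 \<le> F t / t \<and>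
      F t / t \<le> a (Suc (q t)) * (real (Suc (q t)) / real (q t))\<^sup>2"
    using eventually_ge_at_top[of 1]
  proof eventually_elim
    case (elim t)
    define m where "m = q t"
    have m: "real m \<le> sqrt t" "sqrt t < real (Suc m)" "m \<ge> 1"
      using elim real_sqrt_ge_one[of t] unfolding m_def q_def by (auto simp: le_nat_iff) linarith+
    have sq: "(sqrt t)\<^sup>2 = t"
      using elim by simp
    have t: "(real m)\<^sup>2 \<le> t" "t \<le> (real (Suc m))\<^sup>2"
      using power_mono[OF m(1), of 2] power_mono[OF less_imp_le[OF m(2)], of 2] elim
      unfolding sq by auto
    have F: "0 \<le> F ((real m)\<^sup>2)" "F ((real m)\<^sup>2) \<le> F t" "F t \<le> F ((real (Suc m))\<^sup>2)"
      using mono[of 0 "(real m)\<^sup>2"] F0 mono[OF _ t(1)] mono[OF _ t(2)] elim by auto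
    \<comment> \<open>Monotonicity handles the numerators; exchanging one square for the next in the
      denominator costs the factor that tends to \<open>1\<close>.\<close>
    have "a m * (real m / real (Suc m))\<^sup>2 = F ((real m)\<^sup>2) / (real (Suc m))\<^sup>2"
      using m unfolding a_def by (simp add: power_divide del: of_nat_Suc)
    also have "\<dots> \<le> F t / t"
      using F t m elim by (intro frac_le) auto
    finally have 1: "a m * (real m / real (Suc m))\<^sup>2 \<le> F t / t" .
    have "F t / t \<le> F ((real (Suc m))\<^sup>2) / (real m)\<^sup>2"
      using F t m elim by (intro frac_le) auto
    also have "\<dots> = a (Suc m) * (real (Suc m) / real m)\<^sup>2"
      using m unfolding a_def by (simp add: power_divide del: of_nat_Suc)
    finally show ?case
      using 1 unfolding m_def by simp
  qed
  show ?thesis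
    by (rule tendsto_sandwich[OF _ _ lower upper]; use ev in eventually_elim; simp)
qed

text \<open>The omitted initial block is a constant, and \<open>(N + T) / N\<close> tends to
  \<open>1\<close>. This carries averages from the clock of operation over to the clock that starts
  with the first delivery.\<close>

lemma tendsto_average_shift:
  fixes f :: "nat \<Rightarrow> real"
  assumes lim: "(\<lambda>N. (\<Sum>k<N. f k) / real N) \<longlonglongrightarrow> L"
  shows "(\<lambda>N. (\<Sum>k<N. f (T + k)) / real N) \<longlonglongrightarrow> L"
proof -
  have shift: "(\<Sum>k<N. f (T + k)) = (\<Sum>k<N + T. f k) - (\<Sum>k<T. f k)" for N
    by (induction N) (auto simp: add.commute)
  have T: "(\<lambda>N. c / real N) \<longlonglongrightarrow> 0" for c
    by (rule lim_const_over_n)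
  have "(\<lambda>N. (\<Sum>k<N + T. f k) / real (N + T) * (1 + real T / real N) - (\<Sum>k<T. f k) / real N)
      \<longlonglongrightarrow> L * (1 + 0) - 0"
    by (intro tendsto_intros LIMSEQ_ignore_initial_segment[OF lim] T)
  then have lim': "(\<lambda>N. (\<Sum>k<N + T. f k) / real (N + T) * (1 + real T / real N) - (\<Sum>k<T. f k) / real N)
      \<longlonglongrightarrow> L"
    by simp
  show ?thesis
  proof (rule Lim_transform_eventually[OF lim'])
    show "\<forall>\<^sub>F N in sequentially. (\<Sum>k<N + T. f k) / real (N + T) * (1 + real T / real N)
        - (\<Sum>k<T. f k) / real N = (\<Sum>k<N. f (T + k)) / real N"
      using eventually_gt_at_top[of 0]
    proof eventually_elim
      case (elim N)
      then have "1 + real T / real N = real (N + T) / real N" "real (N + T) \<noteq> 0"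
        by (simp_all add: field_simps)
      then show ?case
        unfolding shift by (simp add: diff_divide_distrib)
    qed
  qed
qed

text \<open>Of the constant \<open>3 / 2\<close>, the part \<open>1\<close> is the age right after a
  delivery and \<open>1 / 2\<close> is the mean growth within a slot.\<close>

lemma time_avg_age_tendsto:
  fixes n i :: nat and act :: "nat \<Rightarrow> nat \<Rightarrow> 'a \<Rightarrow> bool" and \<omega> :: 'a
  defines "d \<equiv> \<lambda>k. delivers n act i k \<omega>"
  assumes ex: "\<exists>k. d k" and lim: "(\<lambda>N. (\<Sum>k<N. real (gap d k)) / real N) \<longlonglongrightarrow> L"
  shows "(time_avg_age n act i \<omega> \<longlongrightarrow> L + 3 / 2) at_top"
proof -
  define T where "T = (LEAST k. d k)"
  define c where "c N = real (gap d (T + N)) + 1" for N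
  define F where "F t = integral {0..t} (age n act i \<omega>)" for t
  have age: "age n act i \<omega> t = t - real (nat \<lfloor>t\<rfloor>) + c (nat \<lfloor>t\<rfloor>)" if "t \<ge> 0" for t
    using age_eq[of n act i \<omega> t] ex that unfolding c_def T_def d_def by simp
  have age_nonneg: "age n act i \<omega> t \<ge> 0" if "t \<ge> 0" for t
    unfolding age[OF that] c_def using that by simp
  note int = sawtooth_has_integral[OF age]
  have F_nat: "F (real N) = (\<Sum>k<N. c k + 1 / 2)" for N
    unfolding F_def using int by (rule integral_unique)
  have integrable: "age n act i \<omega> integrable_on {0..t}" if "t \<ge> 0" for t
  proof (rule integrable_on_subinterval)
    show "age n act i \<omega> integrable_on {0..real (nat \<lceil>t\<rceil>)}"
      using int by blast
    show "{0..t} \<subseteq> {0..real (nat \<lceil>t\<rceil>)}"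
      by (auto simp: real_nat_ceiling_ge intro: order_trans)
  qed
  have "(\<lambda>N. (\<Sum>k<N. real (gap d (T + k))) / real N + 3 / 2) \<longlonglongrightarrow> L + 3 / 2"
    by (intro tendsto_intros tendsto_average_shift[OF lim])
  \<comment> \<open>The squares suffice, since the age is nonnegative and its integral is therefore
    monotone in the upper limit.\<close>
  then have lim': "(\<lambda>m. (\<Sum>k<m\<^sup>2. real (gap d (T + k))) / real (m\<^sup>2) + 3 / 2) \<longlonglongrightarrow> L + 3 / 2"
    by (rule filterlim_compose) (intro filterlim_subseq strict_monoI power_strict_mono; simp)
  have "((\<lambda>t. F t / t) \<longlongrightarrow> L + 3 / 2) at_top"
  proof (rule tendsto_average_if_squares)
    fix s t :: real assume "0 \<le> s" "s \<le> t"
    then show "F s \<le> F t"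
      unfolding F_def by (intro integral_subset_le integrable) (auto intro: age_nonneg)
  next
    show "(\<lambda>m. F (real (m\<^sup>2)) / real (m\<^sup>2)) \<longlonglongrightarrow> L + 3 / 2"
    proof (rule Lim_transform_eventually[OF lim'])
      show "\<forall>\<^sub>F m in sequentially. (\<Sum>k<m\<^sup>2. real (gap d (T + k))) / real (m\<^sup>2) + 3 / 2 =
          F (real (m\<^sup>2)) / real (m\<^sup>2)"
        using eventually_gt_at_top[of 0]
        by eventually_elim (simp add: F_nat c_def sum.distrib add_divide_distrib del: of_nat_power)
    qed
  qed (simp add: F_def)
  then show ?thesis
    unfolding F_def time_avg_age_def[abs_def] by simp
qed

section \<open>The geometric distribution\<close>

definition reset_kernel :: "real \<Rightarrow> nat \<Rightarrow> nat pmf" where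
  "reset_kernel p j = map_pmf (\<lambda>b. if b then 0 else Suc j) (bernoulli_pmf p)"

lemma pmf_reset_kernel:
  assumes "0 \<le> p" "p \<le> 1"
  shows "pmf (reset_kernel p j) y = (if y = 0 then p else if y = Suc j then 1 - p else 0)"
proof -
  have "(\<lambda>b. if b then 0 else Suc j) -` {y} =
      (if y = 0 then {True} else if y = Suc j then {False} else {})"
    by (auto split: if_splits)
  then show ?thesis
    using assms unfolding reset_kernel_def pmf_map by (simp add: measure_pmf_single)
qed

text \<open>Every state resets with the same probability, so one step puts mass \<open>p\<close> on
  0 whatever \<open>\<pi>\<close> is, and \<open>Suc j\<close> is entered only from
  \<open>j\<close>. A fixed point thus satisfies a first-order recursion with known start, which
  gives existence and uniqueness together.\<close>

lemma bind_reset_kernel_fixed_iff: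
  assumes p: "0 < p" "p < 1"
  shows "bind_pmf \<pi> (reset_kernel p) = \<pi> \<longleftrightarrow> \<pi> = geometric_pmf p"
proof -
  have zero: "pmf (bind_pmf \<pi> (reset_kernel p)) 0 = p" for \<pi>
    using p by (simp add: pmf_bind pmf_reset_kernel)
  have succ: "pmf (bind_pmf \<pi> (reset_kernel p)) (Suc j) = (1 - p) * pmf \<pi> j" for \<pi> j
  proof -
    have "pmf (bind_pmf \<pi> (reset_kernel p)) (Suc j) =
        measure_pmf.expectation \<pi> (\<lambda>k. (1 - p) * indicator {j} k)"
      using p unfolding pmf_bind by (intro integral_cong_AE) (auto simp: pmf_reset_kernel)
    then show ?thesis
      by (simp add: measure_pmf_single)
  qed
  show ?thesis
  proof
    assume fixed: "bind_pmf \<pi> (reset_kernel p) = \<pi>"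
    have "pmf \<pi> j = (1 - p) ^ j * p" for j
    proof (induction j)
      case 0
      show ?case using zero[of \<pi>] unfolding fixed by simp
    next
      case (Suc j)
      then show ?case using succ[of \<pi> j]
        unfolding fixed by simp
    qed
    then show "\<pi> = geometric_pmf p"
      using p by (intro pmf_eqI) simp
  next
    assume "\<pi> = geometric_pmf p"
    then show "bind_pmf \<pi> (reset_kernel p) = \<pi>"
      using p zero succ by (intro pmf_eqI, rename_tac j, case_tac j) simp_all
  qed
qed

lemma prob_geometric_pmf_atLeast:
  assumes "0 < p" "p < 1"
  shows "measure_pmf.prob (geometric_pmf p) {m..} = (1 - p) ^ m"
proof -
  have "measure_pmf.prob (geometric_pmf p) {..<m} = (\<Sum>i<m. (1 - p) ^ i) * p"
    using assms by (simp add: measure_measure_pmf_finite sum_distrib_right)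
  also have "\<dots> = 1 - (1 - p) ^ m"
    using assms by (simp add: sum_gp_strict)
  finally have "measure_pmf.prob (geometric_pmf p) {..<m} = 1 - (1 - p) ^ m" .
  moreover have "{m..} = UNIV - {..<m}"
    by auto
  ultimately show ?thesis
    using measure_pmf.prob_compl[of "{..<m}" "geometric_pmf p"] by simp
qed

section \<open>Gaps between successes of a Bernoulli process\<close>

text \<open>Stands in for measurability with respect to the first \<open>N + 1\<close> slots. Such a
  function factors through finitely many Booleans, so it takes finitely many values, and
  measurability and integrability along the process follow.\<close>

definition depends_upto :: "nat \<Rightarrow> ((nat \<Rightarrow> bool) \<Rightarrow> 'b) \<Rightarrow> bool" where
  "depends_upto N F \<longleftrightarrow> (\<forall>d d'. (\<forall>k\<le>N. d k = d' k) \<longrightarrow> F d = F d')"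

lemma depends_uptoI: "(\<And>d d'. (\<And>k. k \<le> N \<Longrightarrow> d k = d' k) \<Longrightarrow> F d = F d') \<Longrightarrow> depends_upto N F"
  unfolding depends_upto_def by blast

lemma depends_uptoD: "depends_upto N F \<Longrightarrow> (\<And>k. k \<le> N \<Longrightarrow> d k = d' k) \<Longrightarrow> F d = F d'"
  unfolding depends_upto_def by blast

lemma depends_upto_comp: "depends_upto N F \<Longrightarrow> depends_upto N (\<lambda>d. f (F d))"
  unfolding depends_upto_def by (intro allI impI arg_cong[where f = f]) blast

lemma depends_upto_comp2:
  "depends_upto N F \<Longrightarrow> depends_upto N G \<Longrightarrow> depends_upto N (\<lambda>d. f (F d) (G d))"
  unfolding depends_upto_def by (intro allI impI arg_cong2[where f = f]) blast+

lemma depends_upto_Suc: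
  "depends_upto N F \<Longrightarrow> depends_upto (Suc N) (\<lambda>d. f (F d) (d (Suc N)))"
  unfolding depends_upto_def by (intro allI impI arg_cong2[where f = f]) (auto simp: le_SucI)

lemma depends_upto_gap: "depends_upto N (\<lambda>d. gap d N)"
  by (intro depends_uptoI gap_cong) auto

text \<open>
  With \<open>G\<^sub>k = gap d k\<close> and \<open>b\<^sub>k = of_bool (d k)\<close> one has \<open>G\<^sub>k\<^sub>+\<^sub>1 = (G\<^sub>k + 1) (1 - b\<^sub>k\<^sub>+\<^sub>1)\<close>,
  so the compensator of \<open>G\<close> is \<open>(1 - p) N - p \<Sum> G\<^sub>k\<close> and \<open>gap_martingale\<close> is minus the martingale part.
\<close>

definition gap_martingale :: "real \<Rightarrow> (nat \<Rightarrow> bool) \<Rightarrow> nat \<Rightarrow> real" where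
  "gap_martingale p d N = (\<Sum>k<N. (real (gap d k) + 1) * (of_bool (d (Suc k)) - p))"

lemma depends_upto_gap_martingale: "depends_upto N (\<lambda>d. gap_martingale p d N)"
proof (rule depends_uptoI)
  fix d d' :: "nat \<Rightarrow> bool" assume eq: "\<And>k. k \<le> N \<Longrightarrow> d k = d' k"
  have "gap d k = gap d' k" if "k < N" for k
    using that eq by (intro gap_cong) auto
  then show "gap_martingale p d N = gap_martingale p d' N"
    using eq unfolding gap_martingale_def by (intro sum.cong) auto
qed

text \<open>Sums the one-step identity \<open>G\<^sub>k\<^sub>+\<^sub>1 - G\<^sub>k = (1 - p) - p
  G\<^sub>k - (G\<^sub>k + 1) (b\<^sub>k\<^sub>+\<^sub>1 - p)\<close> from
  \<open>G\<^sub>0 = 0\<close>. Bounds on the martingale thereby become bounds on the sum of the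
  gaps.\<close>

lemma gap_decomposition:
  "real (gap d N) = real N * (1 - p) - p * (\<Sum>k<N. real (gap d k)) - gap_martingale p d N"
  unfolding gap_martingale_def by (induction N) (auto simp: algebra_simps)

text \<open>Abstracts the channel as seen by one node; \<open>delivers n act i\<close> is an
  instance with \<open>p = xi_sa n \<rho>\<close>.\<close>

locale bernoulli_process = prob_space M for M :: "'a measure" +
  fixes D :: "nat \<Rightarrow> 'a \<Rightarrow> bool" and p :: real
  assumes indep: "indep_vars (\<lambda>_. count_space UNIV) D UNIV"
    and prob_success: "\<And>k. prob {\<omega> \<in> space M. D k \<omega>} = p"
    and p_pos: "0 < p" and p_less_1: "p < 1"
begin

section \<open>Independence of the past and the next slot\<close>

lemma measurable_D [measurable]: "D k \<in> measurable M (count_space UNIV)"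
  using indep unfolding indep_vars_def by auto

lemma measurable_gap [measurable]:
  "(\<lambda>\<omega>. gap (\<lambda>k. D k \<omega>) N) \<in> measurable M (count_space UNIV)"
  by (induction N) simp_all

text \<open>The restrictions of the process to the disjoint index sets \<open>{..N}\<close> and
  \<open>{Suc N}\<close> are independent, so the expectation of the product factorises.
  Integrability holds because \<open>F\<close> ranges over finitely many values.\<close>

lemma
  fixes F :: "(nat \<Rightarrow> bool) \<Rightarrow> real" and h :: "bool \<Rightarrow> real"
  assumes F: "depends_upto N F"
  shows integrable_depends_upto: "integrable M (\<lambda>\<omega>. F (\<lambda>k. D k \<omega>))"
    and expectation_past_times_next:
      "expectation (\<lambda>\<omega>. F (\<lambda>k. D k \<omega>) * h (D (Suc N) \<omega>)) =
       expectation (\<lambda>\<omega>. F (\<lambda>k. D k \<omega>)) * (p * h True + (1 - p) * h False)"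
proof -
  let ?C = "\<lambda>_::nat. count_space (UNIV :: bool set)"
  let ?P = "PiE {..N} (\<lambda>_. UNIV :: bool set)"
  have PiM_past: "PiM {..N} ?C = count_space ?P"
    by (intro count_space_PiM_finite) auto
  have fin: "finite ?P"
    by (intro finite_PiE) auto
  have F_eq: "F (\<lambda>k. D k \<omega>) = F (restrict (\<lambda>k. D k \<omega>) {..N})" for \<omega>
    by (intro depends_uptoD[OF F]) auto
  have F_meas: "F \<in> borel_measurable (PiM {..N} ?C)"
    unfolding PiM_past by simp
  have h_meas: "(\<lambda>v. h (v (Suc N))) \<in> borel_measurable (PiM {Suc N} ?C)"
    by measurable
  have ind: "indep_var borel (F \<circ> (\<lambda>\<omega>. restrict (\<lambda>k. D k \<omega>) {..N}))
      borel ((\<lambda>v. h (v (Suc N))) \<circ> (\<lambda>\<omega>. restrict (\<lambda>k. D k \<omega>) {Suc N}))"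
    by (rule indep_var_compose[OF indep_var_restrict[OF indep] F_meas h_meas]) auto
  have F_int: "integrable M (F \<circ> (\<lambda>\<omega>. restrict (\<lambda>k. D k \<omega>) {..N}))"
  proof (rule integrable_const_bound[where B = "Max ((\<lambda>v. \<bar>F v\<bar>) ` ?P)"])
    show "AE \<omega> in M. norm ((F \<circ> (\<lambda>\<omega>. restrict (\<lambda>k. D k \<omega>) {..N})) \<omega>) \<le> Max ((\<lambda>v. \<bar>F v\<bar>) ` ?P)"
      using fin by (intro AE_I2) (auto intro!: Max_ge)
    show "F \<circ> (\<lambda>\<omega>. restrict (\<lambda>k. D k \<omega>) {..N}) \<in> borel_measurable M"
      by (intro measurable_comp[OF _ F_meas] measurable_restrict) simp
  qed
  then show "integrable M (\<lambda>\<omega>. F (\<lambda>k. D k \<omega>))"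
    unfolding F_eq by (simp add: comp_def)
  \<comment> \<open>A function of a Boolean is affine in its indicator, which reduces its mean to
    \<open>p\<close>.\<close>
  have h_eq: "h (D k \<omega>) = (h True - h False) * indicator {\<omega> \<in> space M. D k \<omega>} \<omega> + h False"
    if "\<omega> \<in> space M" for \<omega> k
    using that by (auto simp: indicator_def)
  have h_int: "integrable M (\<lambda>\<omega>. h (D k \<omega>))" for k
    by (subst Bochner_Integration.integrable_cong[OF refl h_eq], assumption)
       (intro Bochner_Integration.integrable_add integrable_mult_right integrable_real_indicator; simp add: emeasure_eq_measure)
  have h_exp: "expectation (\<lambda>\<omega>. h (D k \<omega>)) = p * h True + (1 - p) * h False" for k
  proof -
    have "expectation (\<lambda>\<omega>. h (D k \<omega>)) =
        expectation (\<lambda>\<omega>. (h True - h False) * indicator {\<omega> \<in> space M. D k \<omega>} \<omega> + h False)"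
      by (intro Bochner_Integration.integral_cong h_eq) auto
    also have "\<dots> = (h True - h False) * prob {\<omega> \<in> space M. D k \<omega>} + h False"
      by (subst Bochner_Integration.integral_add; (intro integrable_mult_right integrable_real_indicator)?; simp add: prob_space emeasure_eq_measure)
    finally show ?thesis
      unfolding prob_success by (simp add: algebra_simps)
  qed
  have "expectation (\<lambda>\<omega>. (F \<circ> (\<lambda>\<omega>. restrict (\<lambda>k. D k \<omega>) {..N})) \<omega> *
        ((\<lambda>v. h (v (Suc N))) \<circ> (\<lambda>\<omega>. restrict (\<lambda>k. D k \<omega>) {Suc N})) \<omega>) =
      expectation (F \<circ> (\<lambda>\<omega>. restrict (\<lambda>k. D k \<omega>) {..N})) *
      expectation ((\<lambda>v. h (v (Suc N))) \<circ> (\<lambda>\<omega>. restrict (\<lambda>k. D k \<omega>) {Suc N}))"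
    using h_int by (intro indep_var_lebesgue_integral[OF ind F_int]) (simp add: comp_def)
  then show "expectation (\<lambda>\<omega>. F (\<lambda>k. D k \<omega>) * h (D (Suc N) \<omega>)) =
       expectation (\<lambda>\<omega>. F (\<lambda>k. D k \<omega>)) * (p * h True + (1 - p) * h False)"
    unfolding F_eq by (simp add: comp_def h_exp)
qed

text \<open>The preceding factorisation applied to indicators: after any past, the next slot
  succeeds with probability \<open>p\<close>.\<close>

lemma prob_past_and_next:
  assumes Q: "depends_upto N Q"
  shows "prob {\<omega> \<in> space M. Q (\<lambda>k. D k \<omega>) \<and> D (Suc N) \<omega>} = p * prob {\<omega> \<in> space M. Q (\<lambda>k. D k \<omega>)}"
    and "{\<omega> \<in> space M. Q (\<lambda>k. D k \<omega>)} \<in> events"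
proof -
  have dep: "depends_upto N (\<lambda>d. of_bool (Q d) :: real)"
    by (rule depends_upto_comp[OF Q])
  have "(\<lambda>\<omega>. of_bool (Q (\<lambda>k. D k \<omega>)) :: real) \<in> borel_measurable M"
    using integrable_depends_upto[OF dep] by (rule borel_measurable_integrable)
  then have "{\<omega> \<in> space M. of_bool (Q (\<lambda>k. D k \<omega>)) = (1::real)} \<in> events"
    by measurable
  then show ev[measurable]: "{\<omega> \<in> space M. Q (\<lambda>k. D k \<omega>)} \<in> events"
    by simp
  have "expectation (\<lambda>\<omega>. of_bool (Q (\<lambda>k. D k \<omega>)) :: real) = expectation (indicator {\<omega> \<in> space M. Q (\<lambda>k. D k \<omega>)})"
    by (intro Bochner_Integration.integral_cong) (auto simp: indicator_def)
  moreover have "expectation (\<lambda>\<omega>. of_bool (Q (\<lambda>k. D k \<omega>)) * of_bool (D (Suc N) \<omega>) :: real) =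
      expectation (indicator {\<omega> \<in> space M. Q (\<lambda>k. D k \<omega>) \<and> D (Suc N) \<omega>})"
    by (intro Bochner_Integration.integral_cong) (auto simp: indicator_def)
  ultimately show "prob {\<omega> \<in> space M. Q (\<lambda>k. D k \<omega>) \<and> D (Suc N) \<omega>} = p * prob {\<omega> \<in> space M. Q (\<lambda>k. D k \<omega>)}"
    using expectation_past_times_next[OF dep, of of_bool] by (simp add: mult.commute)
qed

text \<open>Each further failure is the complement of a success within an event of the past, and so
  contributes one factor \<open>1 - p\<close>.\<close>

lemma prob_failures_after:
  assumes Q: "depends_upto m Q"
  shows "prob {\<omega> \<in> space M. Q (\<lambda>k. D k \<omega>) \<and> (\<forall>j<k. \<not> D (Suc (m + j)) \<omega>)} =
    (1 - p) ^ k * prob {\<omega> \<in> space M. Q (\<lambda>k. D k \<omega>)}"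
proof (induction k)
  case 0
  then show ?case by simp
next
  case (Suc k)
  let ?Q = "\<lambda>d. Q d \<and> (\<forall>j<k. \<not> d (Suc (m + j)))"
  have dep: "depends_upto (m + k) ?Q"
  proof (rule depends_uptoI)
    fix d d' :: "nat \<Rightarrow> bool" assume eq: "\<And>j. j \<le> m + k \<Longrightarrow> d j = d' j"
    then have "Q d = Q d'"
      by (intro depends_uptoD[OF Q]) auto
    then show "?Q d = ?Q d'"
      using eq by auto
  qed
  note P = prob_past_and_next[OF dep]
  have diff: "{\<omega> \<in> space M. Q (\<lambda>k. D k \<omega>) \<and> (\<forall>j<Suc k. \<not> D (Suc (m + j)) \<omega>)} =
      {\<omega> \<in> space M. ?Q (\<lambda>k. D k \<omega>)} - {\<omega> \<in> space M. ?Q (\<lambda>k. D k \<omega>) \<and> D (Suc (m + k)) \<omega>}"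
  proof -
    have "{x \<in> S. A x \<and> (B x \<and> \<not> C x)} = {x \<in> S. A x \<and> B x} - {x \<in> S. (A x \<and> B x) \<and> C x}"
      for S :: "'a set" and A B C
      by blast
    moreover have "(\<forall>j<Suc k. \<not> R j) \<longleftrightarrow> (\<forall>j<k. \<not> R j) \<and> \<not> R k" for R
      by (auto simp: less_Suc_eq)
    ultimately show ?thesis
      by (simp only:)
  qed
  have "prob {\<omega> \<in> space M. Q (\<lambda>k. D k \<omega>) \<and> (\<forall>j<Suc k. \<not> D (Suc (m + j)) \<omega>)} =
      prob {\<omega> \<in> space M. ?Q (\<lambda>k. D k \<omega>)} -
      prob {\<omega> \<in> space M. ?Q (\<lambda>k. D k \<omega>) \<and> D (Suc (m + k)) \<omega>}"
    unfolding diff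
  proof (rule finite_measure_Diff)
    have "{\<omega> \<in> space M. ?Q (\<lambda>k. D k \<omega>) \<and> D (Suc (m + k)) \<omega>} =
        {\<omega> \<in> space M. ?Q (\<lambda>k. D k \<omega>)} \<inter> {\<omega> \<in> space M. D (Suc (m + k)) \<omega>}"
      by auto
    also have "\<dots> \<in> events"
      using P(2) by (intro sets.Int) auto
    finally show "{\<omega> \<in> space M. ?Q (\<lambda>k. D k \<omega>) \<and> D (Suc (m + k)) \<omega>} \<in> events" .
  qed (use P(2) in auto)
  then show ?case
    unfolding P(1) Suc.IH by (simp add: algebra_simps)
qed

lemma AE_success: "AE \<omega> in M. \<exists>k. D k \<omega>"
proof -
  have le: "prob {\<omega> \<in> space M. \<forall>k. \<not> D k \<omega>} \<le> (1 - p) ^ N" for N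
  proof -
    \<comment> \<open>Only slots 1 to \<open>N\<close> are required to fail on the right; ignoring
      slot 0 enlarges the event.\<close>
    have "prob {\<omega> \<in> space M. \<forall>k. \<not> D k \<omega>} \<le>
        prob {\<omega> \<in> space M. True \<and> (\<forall>j<N. \<not> D (Suc (0 + j)) \<omega>)}"
      by (intro finite_measure_mono) auto
    also have "\<dots> = (1 - p) ^ N"
      using prob_failures_after[of 0 "\<lambda>_. True" N] by (simp add: depends_upto_def prob_space)
    finally show ?thesis .
  qed
  have "prob {\<omega> \<in> space M. \<forall>k. \<not> D k \<omega>} \<le> 0"
    using le p_pos p_less_1 by (intro LIMSEQ_le_const[OF LIMSEQ_power_zero[of "1 - p"]]) auto
  then have "prob {\<omega> \<in> space M. \<forall>k. \<not> D k \<omega>} = 0"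
    using measure_nonneg[of M] by (intro antisym) auto
  then show ?thesis
    by (subst (asm) prob_eq_0) (auto elim: eventually_mono)
qed

section \<open>Second moments of the gap and of the martingale\<close>

text \<open>A slot either resets \<open>?G\<close> to 1 or raises it by 1. Failure has weight
  \<open>1 - p\<close>, and raising costs a factor \<open>1 + p\<close> plus a constant, so the
  second moment contracts by \<open>1 - p\<^sup>2\<close> up to the constant
  \<open>c\<close>.\<close>

lemma expectation_gap_sq_bounded:
  obtains C where "\<And>N. expectation (\<lambda>\<omega>. (real (gap (\<lambda>k. D k \<omega>) N) + 1)\<^sup>2) \<le> C"
proof -
  let ?G = "\<lambda>N \<omega>. real (gap (\<lambda>k. D k \<omega>) N) + 1"
  have int: "integrable M (\<lambda>\<omega>. (?G N \<omega>)\<^sup>2)" "integrable M (\<lambda>\<omega>. (?G N \<omega> + 1)\<^sup>2)" for N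
    by (rule integrable_depends_upto[OF depends_upto_comp[OF depends_upto_gap]])+
  define c where "c = p + (1 - p) * (1 + 1 / p)"
  have step: "expectation (\<lambda>\<omega>. (?G (Suc N) \<omega>)\<^sup>2) \<le> (1 - p\<^sup>2) * expectation (\<lambda>\<omega>. (?G N \<omega>)\<^sup>2) + c" for N
  proof -
    have dep: "depends_upto N (\<lambda>d. (real (gap d N) + 1 + 1)\<^sup>2 - 1)"
      by (rule depends_upto_comp[OF depends_upto_gap])
    have "expectation (\<lambda>\<omega>. (?G (Suc N) \<omega>)\<^sup>2) =
        expectation (\<lambda>\<omega>. 1 + ((?G N \<omega> + 1)\<^sup>2 - 1) * of_bool (\<not> D (Suc N) \<omega>))"
      by (intro Bochner_Integration.integral_cong) auto
    also have "\<dots> = 1 + expectation (\<lambda>\<omega>. ((?G N \<omega> + 1)\<^sup>2 - 1) * of_bool (\<not> D (Suc N) \<omega>))"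
    proof (subst Bochner_Integration.integral_add)
      have "depends_upto (Suc N) (\<lambda>d. ((real (gap d N) + 1 + 1)\<^sup>2 - 1) * of_bool (\<not> d (Suc N)))"
        by (rule depends_upto_Suc[OF dep])
      then show "integrable M (\<lambda>\<omega>. ((?G N \<omega> + 1)\<^sup>2 - 1) * of_bool (\<not> D (Suc N) \<omega>))"
        by (rule integrable_depends_upto)
    qed (auto simp: prob_space)
    also have "\<dots> = 1 + (1 - p) * (expectation (\<lambda>\<omega>. (?G N \<omega> + 1)\<^sup>2) - 1)"
      using expectation_past_times_next[OF dep, of "\<lambda>b. of_bool (\<not> b)"] int
      by (simp add: prob_space)
    \<comment> \<open>Young's inequality \<open>2 g \<le> p g\<^sup>2 + 1 / p\<close>, with the
      weight chosen so that \<open>(1 - p) (1 + p) < 1\<close>.\<close>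
    also have "expectation (\<lambda>\<omega>. (?G N \<omega> + 1)\<^sup>2) \<le> expectation (\<lambda>\<omega>. (1 + p) * (?G N \<omega>)\<^sup>2 + (1 + 1 / p))"
    proof (intro integral_mono int Bochner_Integration.integrable_add integrable_mult_right)
      fix \<omega>
      have "0 \<le> (p * ?G N \<omega> - 1)\<^sup>2 / p"
        using p_pos by simp
      then show "(?G N \<omega> + 1)\<^sup>2 \<le> (1 + p) * (?G N \<omega>)\<^sup>2 + (1 + 1 / p)"
        using p_pos by (simp add: power2_eq_square field_simps)
    qed auto
    also have "\<dots> = (1 + p) * expectation (\<lambda>\<omega>. (?G N \<omega>)\<^sup>2) + (1 + 1 / p)"
      using int by (simp add: prob_space)
    finally have "expectation (\<lambda>\<omega>. (?G (Suc N) \<omega>)\<^sup>2) \<le>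
        1 + (1 - p) * ((1 + p) * expectation (\<lambda>\<omega>. (?G N \<omega>)\<^sup>2) + (1 + 1 / p) - 1)"
      using p_less_1 by simp
    also have "\<dots> = (1 - p\<^sup>2) * expectation (\<lambda>\<omega>. (?G N \<omega>)\<^sup>2) + c"
      unfolding c_def by (simp add: algebra_simps power2_eq_square)
    finally show ?thesis .
  qed
  \<comment> \<open>\<open>c / p\<^sup>2\<close> is the fixed point of the recursion, and
    \<open>1\<close> is the initial value.\<close>
  have "expectation (\<lambda>\<omega>. (?G N \<omega>)\<^sup>2) \<le> max 1 (c / p\<^sup>2)" for N
  proof (induction N)
    case 0
    then show ?case by (simp add: prob_space)
  next
    case (Suc N)
    have "0 \<le> 1 - p\<^sup>2"
      using p_pos p_less_1 by (simp add: power_le_one)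
    then have "expectation (\<lambda>\<omega>. (?G (Suc N) \<omega>)\<^sup>2) \<le> (1 - p\<^sup>2) * max 1 (c / p\<^sup>2) + c"
      using step[of N] mult_left_mono[OF Suc, of "1 - p\<^sup>2"] by linarith
    moreover have "c \<le> p\<^sup>2 * max 1 (c / p\<^sup>2)"
      using mult_left_mono[of "c / p\<^sup>2" "max 1 (c / p\<^sup>2)" "p\<^sup>2"] p_pos by simp
    moreover have "(1 - p\<^sup>2) * max 1 (c / p\<^sup>2) + p\<^sup>2 * max 1 (c / p\<^sup>2) = max 1 (c / p\<^sup>2)"
      by (simp add: left_diff_distrib)
    ultimately show ?case
      by linarith
  qed
  then show ?thesis
    using that by blast
qed

text \<open>The factor \<open>of_bool (D (Suc N) \<omega>) - p\<close> has mean zero and is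
  independent of the past, so the cross term vanishes. Its square is at most 1, so each slot adds at
  most \<open>C\<close>.\<close>

lemma expectation_gap_martingale_sq:
  assumes C: "\<And>N. expectation (\<lambda>\<omega>. (real (gap (\<lambda>k. D k \<omega>) N) + 1)\<^sup>2) \<le> C"
  shows "expectation (\<lambda>\<omega>. (gap_martingale p (\<lambda>k. D k \<omega>) N)\<^sup>2) \<le> real N * C"
proof (induction N)
  case 0
  then show ?case by (simp add: gap_martingale_def)
next
  case (Suc N)
  let ?W = "\<lambda>d. gap_martingale p d N" and ?G = "\<lambda>d. real (gap d N) + 1"
  have dep: "depends_upto N (\<lambda>d. (?W d)\<^sup>2)" "depends_upto N (\<lambda>d. 2 * ?W d * ?G d)"
      "depends_upto N (\<lambda>d. (?G d)\<^sup>2)"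
    by (rule depends_upto_comp[OF depends_upto_gap_martingale],
        rule depends_upto_comp2[OF depends_upto_gap_martingale depends_upto_gap],
        rule depends_upto_comp[OF depends_upto_gap])
  have int: "integrable M (\<lambda>\<omega>. F (\<lambda>k. D k \<omega>) * h (D (Suc N) \<omega>))"
    if "depends_upto N F" for F and h :: "bool \<Rightarrow> real"
  proof -
    have "depends_upto (Suc N) (\<lambda>d. F d * h (d (Suc N)))"
      by (rule depends_upto_Suc[OF that])
    then show ?thesis
      by (rule integrable_depends_upto)
  qed
  have "expectation (\<lambda>\<omega>. (gap_martingale p (\<lambda>k. D k \<omega>) (Suc N))\<^sup>2) =
      expectation (\<lambda>\<omega>. (?W (\<lambda>k. D k \<omega>))\<^sup>2 +
        (2 * ?W (\<lambda>k. D k \<omega>) * ?G (\<lambda>k. D k \<omega>) * (of_bool (D (Suc N) \<omega>) - p) +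
        (?G (\<lambda>k. D k \<omega>))\<^sup>2 * (of_bool (D (Suc N) \<omega>) - p)\<^sup>2))"
    by (intro Bochner_Integration.integral_cong)
       (auto simp: gap_martingale_def power2_eq_square algebra_simps)
  also have "\<dots> = expectation (\<lambda>\<omega>. (?W (\<lambda>k. D k \<omega>))\<^sup>2) +
      (expectation (\<lambda>\<omega>. 2 * ?W (\<lambda>k. D k \<omega>) * ?G (\<lambda>k. D k \<omega>) * (of_bool (D (Suc N) \<omega>) - p)) +
       expectation (\<lambda>\<omega>. (?G (\<lambda>k. D k \<omega>))\<^sup>2 * (of_bool (D (Suc N) \<omega>) - p)\<^sup>2))"
    using integrable_depends_upto[OF dep(1)] int[OF dep(2), of "\<lambda>b. of_bool b - p"]
      int[OF dep(3), of "\<lambda>b. (of_bool b - p)\<^sup>2"]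
    by (simp add: Bochner_Integration.integral_add Bochner_Integration.integrable_add)
  also have "expectation (\<lambda>\<omega>. 2 * ?W (\<lambda>k. D k \<omega>) * ?G (\<lambda>k. D k \<omega>) * (of_bool (D (Suc N) \<omega>) - p)) = 0"
    using expectation_past_times_next[OF dep(2), of "\<lambda>b. of_bool b - p"] by (simp add: algebra_simps)
  also have "expectation (\<lambda>\<omega>. (?G (\<lambda>k. D k \<omega>))\<^sup>2 * (of_bool (D (Suc N) \<omega>) - p)\<^sup>2) \<le>
      expectation (\<lambda>\<omega>. (?G (\<lambda>k. D k \<omega>))\<^sup>2)"
  proof (intro integral_mono int[OF dep(3), of "\<lambda>b. (of_bool b - p)\<^sup>2"] integrable_depends_upto[OF dep(3)])
    fix \<omega>
    have "(of_bool (D (Suc N) \<omega>) - p)\<^sup>2 \<le> 1"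
      using p_pos p_less_1 by (cases "D (Suc N) \<omega>") (simp_all add: abs_square_le_1)
    then show "(?G (\<lambda>k. D k \<omega>))\<^sup>2 * (of_bool (D (Suc N) \<omega>) - p)\<^sup>2 \<le> (?G (\<lambda>k. D k \<omega>))\<^sup>2"
      by (intro mult_left_le) auto
  qed
  also note C
  also note Suc
  finally show ?case
    by (simp add: algebra_simps)
qed

section \<open>Almost sure averages of the gaps\<close>

text \<open>The normalised squares \<open>u m\<close> have summable means, so their sum is almost
  surely finite and its terms tend to zero.\<close>

lemma AE_gap_squares_average:
  "AE \<omega> in M. (\<lambda>m. (\<Sum>k<m\<^sup>2. real (gap (\<lambda>k. D k \<omega>) k)) / real (m\<^sup>2)) \<longlonglongrightarrow> (1 - p) / p"
proof -
  obtain C where C: "\<And>N. expectation (\<lambda>\<omega>. (real (gap (\<lambda>k. D k \<omega>) N) + 1)\<^sup>2) \<le> C"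
    by (rule expectation_gap_sq_bounded) blast
  \<comment> \<open>By \<open>gap_decomposition\<close> this is \<open>N (1 - p)\<close> minus
    \<open>p\<close> times the sum of the gaps, so the claim amounts to \<open>Z N / N\<close>
    tending to 0 along the squares.\<close>
  define Z where "Z N \<omega> = real (gap (\<lambda>k. D k \<omega>) N) + gap_martingale p (\<lambda>k. D k \<omega>) N" for N \<omega>
  have depZ: "depends_upto N (\<lambda>d. (real (gap d N) + gap_martingale p d N)\<^sup>2)" for N
    by (rule depends_upto_comp2[OF depends_upto_gap depends_upto_gap_martingale])
  have intZ: "integrable M (\<lambda>\<omega>. (Z N \<omega>)\<^sup>2)" for N
    unfolding Z_def using integrable_depends_upto[OF depZ] .
  have EZ: "expectation (\<lambda>\<omega>. (Z N \<omega>)\<^sup>2) \<le> 2 * C + 2 * C * real N" for N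
  proof -
    have dep: "depends_upto N (\<lambda>d. (real (gap d N) + 1)\<^sup>2)" "depends_upto N (\<lambda>d. (gap_martingale p d N)\<^sup>2)"
      by (rule depends_upto_comp[OF depends_upto_gap] depends_upto_comp[OF depends_upto_gap_martingale])+
    have "expectation (\<lambda>\<omega>. (Z N \<omega>)\<^sup>2) \<le>
      expectation (\<lambda>\<omega>. 2 * (real (gap (\<lambda>k. D k \<omega>) N) + 1)\<^sup>2 + 2 * (gap_martingale p (\<lambda>k. D k \<omega>) N)\<^sup>2)"
    proof (intro integral_mono intZ Bochner_Integration.integrable_add integrable_mult_right
        integrable_depends_upto[OF dep(1)] integrable_depends_upto[OF dep(2)])
      fix \<omega>
      define g w where "g = real (gap (\<lambda>k. D k \<omega>) N)" and "w = gap_martingale p (\<lambda>k. D k \<omega>) N"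
      \<comment> \<open>The parallelogram identity bounds \<open>(g + w)\<^sup>2\<close> without a
        mixed term.\<close>
      have "(g + w)\<^sup>2 + (g - w)\<^sup>2 = 2 * g\<^sup>2 + 2 * w\<^sup>2"
        by (simp add: power2_eq_square algebra_simps)
      moreover have "g\<^sup>2 \<le> (g + 1)\<^sup>2"
        unfolding g_def by (intro power_mono) auto
      ultimately show "(Z N \<omega>)\<^sup>2 \<le> 2 * (g + 1)\<^sup>2 + 2 * w\<^sup>2"
        unfolding Z_def g_def[symmetric] w_def[symmetric]
        using zero_le_power2[of "g - w"] by linarith
    qed
    also have "\<dots> = 2 * expectation (\<lambda>\<omega>. (real (gap (\<lambda>k. D k \<omega>) N) + 1)\<^sup>2) +
        2 * expectation (\<lambda>\<omega>. (gap_martingale p (\<lambda>k. D k \<omega>) N)\<^sup>2)"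
      using integrable_depends_upto[OF dep(1)] integrable_depends_upto[OF dep(2)] by simp
    also have "\<dots> \<le> 2 * C + 2 * (real N * C)"
      using C[of N] expectation_gap_martingale_sq[OF C, of N] by linarith
    finally show ?thesis by (simp add: algebra_simps)
  qed
  define u where "u m \<omega> = (Z (m\<^sup>2) \<omega> / real (m\<^sup>2))\<^sup>2" for m \<omega>
  have int_u: "integrable M (u m)" for m
    unfolding u_def power_divide using intZ by simp
  have C_nonneg: "C \<ge> 0"
    using C[of 0] by (simp add: prob_space)
  \<comment> \<open>For \<open>m \<ge> 1\<close> the constant \<open>2 * C\<close> is absorbed into
    the quadratic term; for \<open>m = 0\<close> both sides are 0, since division by zero yields
    0.\<close>
  have Eu: "expectation (u m) \<le> 4 * C * inverse ((real m)\<^sup>2)" for m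
  proof (cases "m = 0")
    case False
    then have m: "(real m)\<^sup>2 \<ge> 1"
      by (simp add: Suc_leI)
    have "expectation (u m) = expectation (\<lambda>\<omega>. (Z (m\<^sup>2) \<omega>)\<^sup>2) / ((real m)\<^sup>2)\<^sup>2"
      unfolding u_def power_divide by simp
    also have "\<dots> \<le> (2 * C + 2 * C * (real m)\<^sup>2) / ((real m)\<^sup>2)\<^sup>2"
      using EZ[of "m\<^sup>2"] by (intro divide_right_mono) auto
    also have "\<dots> \<le> (4 * C * (real m)\<^sup>2) / ((real m)\<^sup>2)\<^sup>2"
      using mult_left_mono[OF m, of "2 * C"] C_nonneg by (intro divide_right_mono) auto
    also have "\<dots> = 4 * C * inverse ((real m)\<^sup>2)"
      using False by (simp add: field_simps power2_eq_square)
    finally show ?thesis .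
  qed (simp add: u_def[abs_def])
  have Eu_nonneg: "0 \<le> expectation (u m)" for m
    by (intro Bochner_Integration.integral_nonneg) (simp add: u_def)
  have sum_Eu: "summable (\<lambda>m. expectation (u m))"
  proof (rule summable_comparison_test'[where N = 0])
    show "summable (\<lambda>m. 4 * C * inverse ((real m)\<^sup>2))"
      by (intro summable_mult inverse_power_summable) simp
    show "norm (expectation (u m)) \<le> 4 * C * inverse ((real m)\<^sup>2)" for m
      using Eu[of m] Eu_nonneg[of m] by simp
  qed
  \<comment> \<open>Sum and expectation are exchanged in the extended nonnegative reals, where a
    finite mean forces almost sure finiteness.\<close>
  have "(\<integral>\<^sup>+\<omega>. (\<Sum>m. ennreal (u m \<omega>)) \<partial>M) = (\<Sum>m. \<integral>\<^sup>+\<omega>. ennreal (u m \<omega>) \<partial>M)"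
    using int_u by (intro nn_integral_suminf) auto
  also have "\<dots> = (\<Sum>m. ennreal (expectation (u m)))"
    by (intro suminf_cong nn_integral_eq_integral int_u) (simp add: u_def)
  also have "\<dots> \<noteq> \<infinity>"
    using suminf_ennreal2[OF Eu_nonneg sum_Eu] by (simp only: ennreal_neq_top infinity_ennreal_def not_False_eq_True)
  finally have "AE \<omega> in M. (\<Sum>m. ennreal (u m \<omega>)) \<noteq> \<infinity>"
    using int_u by (intro nn_integral_PInf_AE) auto
  then show ?thesis
  proof eventually_elim
    case (elim \<omega>)
    then have "summable (\<lambda>m. u m \<omega>)"
      by (intro summable_suminf_not_top) (auto simp: u_def)
    then have "(\<lambda>m. u m \<omega>) \<longlonglongrightarrow> 0"
      by (rule summable_LIMSEQ_zero)
    then have "(\<lambda>m. sqrt (u m \<omega>)) \<longlonglongrightarrow> 0"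
      using tendsto_real_sqrt[of "\<lambda>m. u m \<omega>" 0] by simp
    then have "(\<lambda>m. Z (m\<^sup>2) \<omega> / real (m\<^sup>2)) \<longlonglongrightarrow> 0"
      unfolding u_def real_sqrt_abs by (rule tendsto_rabs_zero_cancel)
    then have "(\<lambda>m. (1 - p) / p - Z (m\<^sup>2) \<omega> / real (m\<^sup>2) / p) \<longlonglongrightarrow> (1 - p) / p - 0 / p"
      using p_pos by (intro tendsto_intros) auto
    then have lim: "(\<lambda>m. (1 - p) / p - Z (m\<^sup>2) \<omega> / real (m\<^sup>2) / p) \<longlonglongrightarrow> (1 - p) / p"
      by simp
    show ?case
    proof (rule Lim_transform_eventually[OF lim])
      show "\<forall>\<^sub>F m in sequentially. (1 - p) / p - Z (m\<^sup>2) \<omega> / real (m\<^sup>2) / p =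
          (\<Sum>k<m\<^sup>2. real (gap (\<lambda>k. D k \<omega>) k)) / real (m\<^sup>2)"
        using eventually_gt_at_top[of 0]
      proof eventually_elim
        case (elim m)
        define s where "s = (\<Sum>k<m\<^sup>2. real (gap (\<lambda>k. D k \<omega>) k))"
        define N where "N = real (m\<^sup>2)"
        have Z_eq: "Z (m\<^sup>2) \<omega> = N * (1 - p) - p * s"
          using gap_decomposition[of "\<lambda>k. D k \<omega>" "m\<^sup>2" p] unfolding Z_def s_def N_def by linarith
        have "N > 0"
          using elim unfolding N_def by simp
        then show ?case
          unfolding s_def[symmetric] N_def[symmetric] Z_eq using p_pos by (simp add: field_simps)
      qed
    qed
  qed
qed

text \<open>The partial sums of nonnegative gaps form a monotone step function of real time, so
  their averages along the squares decide the limit.\<close>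

lemma AE_gap_average:
  "AE \<omega> in M. (\<lambda>N. (\<Sum>k<N. real (gap (\<lambda>k. D k \<omega>) k)) / real N) \<longlonglongrightarrow> (1 - p) / p"
  using AE_gap_squares_average
proof eventually_elim
  case (elim \<omega>)
  define F where "F t = (\<Sum>k<nat \<lfloor>t\<rfloor>. real (gap (\<lambda>k. D k \<omega>) k))" for t :: real
  have "((\<lambda>t. F t / t) \<longlongrightarrow> (1 - p) / p) at_top"
  proof (rule tendsto_average_if_squares)
    fix s t :: real assume "0 \<le> s" "s \<le> t"
    then have "nat \<lfloor>s\<rfloor> \<le> nat \<lfloor>t\<rfloor>"
      by (intro nat_mono floor_mono)
    then show "F s \<le> F t"
      unfolding F_def by (intro sum_mono2) auto
  qed (use elim in \<open>simp_all add: F_def del: of_nat_power\<close>)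
  from filterlim_compose[OF this filterlim_real_sequentially] show ?case
    unfolding F_def by simp
qed

definition first_success :: "'a \<Rightarrow> nat" where
  "first_success \<omega> = (LEAST k. D k \<omega>)"

lemma measurable_first_success [measurable]: "first_success \<in> measurable M (count_space UNIV)"
  unfolding first_success_def[abs_def] by measurable

section \<open>The Markov chain of gaps\<close>

text \<open>The past of the chain when the first success falls in slot \<open>m\<close>. For fixed
  \<open>m\<close> this concerns slots up to \<open>m + k\<close> only, unlike the same event
  written with \<open>first_success\<close>.\<close>

definition first_and_gaps :: "nat \<Rightarrow> nat \<Rightarrow> (nat \<Rightarrow> nat) \<Rightarrow> (nat \<Rightarrow> bool) \<Rightarrow> bool" where
  "first_and_gaps m k x d \<longleftrightarrow> d m \<and> (\<forall>j<m. \<not> d j) \<and> (\<forall>j\<le>k. gap d (m + j) = x j)"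

lemma depends_upto_first_and_gaps: "depends_upto (m + k) (first_and_gaps m k x)"
proof (rule depends_uptoI)
  fix d d' :: "nat \<Rightarrow> bool" assume eq: "\<And>j. j \<le> m + k \<Longrightarrow> d j = d' j"
  have "gap d (m + j) = gap d' (m + j)" if "j \<le> k" for j
    using eq that by (intro gap_cong) auto
  moreover have "d j = d' j" if "j < m" for j
    using eq that by auto
  moreover have "d m = d' m"
    using eq by auto
  ultimately show "first_and_gaps m k x d = first_and_gaps m k x d'"
    unfolding first_and_gaps_def by simp
qed

lemma first_and_gaps_iff:
  assumes "\<exists>m. D m \<omega>"
  shows "first_and_gaps m k x (\<lambda>j. D j \<omega>) \<longleftrightarrow>
    m = first_success \<omega> \<and> (\<forall>j\<le>k. gap (\<lambda>j. D j \<omega>) (first_success \<omega> + j) = x j)"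
proof -
  have "D (first_success \<omega>) \<omega>"
    unfolding first_success_def by (rule LeastI_ex[OF assms])
  moreover have "\<not> D j \<omega>" if "j < first_success \<omega>" for j
    using that unfolding first_success_def by (rule not_less_Least)
  ultimately have "D m \<omega> \<and> (\<forall>j<m. \<not> D j \<omega>) \<longleftrightarrow> m = first_success \<omega>"
    by (metis linorder_neqE_nat)
  then show ?thesis
    unfolding first_and_gaps_def by auto
qed

text \<open>Conditioning on the slot of the first success turns the random time shift into a fixed one.\<close>

lemma markov_chain_reset_kernel:
  assumes meas: "\<And>k. X k \<in> measurable M (count_space UNIV)"
    and X: "\<And>k \<omega>. \<exists>m. D m \<omega> \<Longrightarrow> X k \<omega> = gap (\<lambda>m. D m \<omega>) (first_success \<omega> + k)"
  shows "markov_chain M X (reset_kernel p)"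
  unfolding markov_chain_def
proof (intro conjI allI impI meas)
  fix k and x :: "nat \<Rightarrow> nat"
  note [measurable] = meas
  let ?Y = "\<lambda>\<omega>. \<forall>j\<le>k. X j \<omega> = x j"
  assume ne: "prob {\<omega> \<in> space M. ?Y \<omega>} \<noteq> 0"
  \<comment> \<open>\<open>A m\<close> splits the past of the chain by the slot of the first
    success, and \<open>R m\<close> is the part of \<open>A m\<close> followed by a reset.\<close>
  define A where "A m = {\<omega> \<in> space M. first_and_gaps m k x (\<lambda>j. D j \<omega>)}" for m
  define R where "R m = {\<omega> \<in> space M. first_and_gaps m k x (\<lambda>j. D j \<omega>) \<and> D (Suc (m + k)) \<omega>}" for m
  note past = prob_past_and_next[OF depends_upto_first_and_gaps[of _ k x], folded A_def R_def]
  have A_events: "A m \<in> events" for m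
    by (rule past(2))
  have "R m = A m \<inter> {\<omega> \<in> space M. D (Suc (m + k)) \<omega>}" for m
    unfolding R_def A_def by auto
  then have R_events: "R m \<in> events" for m
    using A_events by auto
  have first: "m = first_success \<omega>" if "first_and_gaps m k x (\<lambda>j. D j \<omega>)" for m \<omega>
  proof -
    have "\<exists>m. D m \<omega>"
      using that by (auto simp: first_and_gaps_def)
    from first_and_gaps_iff[OF this] that show ?thesis
      by (rule iffD1[THEN conjunct1])
  qed
  have R_A: "R m \<subseteq> A m" for m
    unfolding R_def A_def by (rule Collect_mono) simp
  have disj_A: "A m \<inter> A m' = {}" if "m \<noteq> m'" for m m'
  proof (rule equals0I)
    fix \<omega> assume "\<omega> \<in> A m \<inter> A m'"
    then have "m = first_success \<omega>" "m' = first_success \<omega>"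
      unfolding A_def by (simp_all add: first)
    then show False
      using that by simp
  qed
  have disj_R: "R m \<inter> R m' = {}" if "m \<noteq> m'" for m m'
    using disj_A[OF that] R_A[of m] R_A[of m'] by auto
  have disj: "disjoint_family A" "disjoint_family R"
    unfolding disjoint_family_on_def using disj_A disj_R by simp_all
  have sums_A: "(\<lambda>m. prob (A m)) sums prob (\<Union>m. A m)"
    using A_events disj(1) by (intro finite_measure_UNION) auto
  have "(\<lambda>m. prob (R m)) sums prob (\<Union>m. R m)"
    using R_events disj(2) by (intro finite_measure_UNION) auto
  \<comment> \<open>The factor \<open>p\<close> is the same for every \<open>m\<close>, so it
    survives the summation over the first success.\<close>
  then have prob_R: "prob (\<Union>m. R m) = p * prob (\<Union>m. A m)"
    using sums_mult[OF sums_A, of p] unfolding past(1) by (rule sums_unique2)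
  have R_subset: "(\<Union>m. R m) \<subseteq> (\<Union>m. A m)"
    by (intro UN_mono R_A) simp
  have prob_diff: "prob ((\<Union>m. A m) - (\<Union>m. R m)) = (1 - p) * prob (\<Union>m. A m)"
    using A_events R_events R_subset
    by (subst finite_measure_Diff) (auto simp: prob_R left_diff_distrib)
  have AE_A: "AE \<omega> in M. \<omega> \<in> {\<omega> \<in> space M. ?Y \<omega>} \<longleftrightarrow> \<omega> \<in> (\<Union>m. A m)"
    using AE_success AE_space
  proof eventually_elim
    case (elim \<omega>)
    then show ?case
      unfolding A_def by (simp add: X first_and_gaps_iff)
  qed
  have prob_A: "prob {\<omega> \<in> space M. ?Y \<omega>} = prob (\<Union>m. A m)"
    using A_events by (intro measure_eq_AE[OF AE_A]) auto
  \<comment> \<open>Up to a null set the chain moves from \<open>x k\<close> only to 0 or to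
    \<open>Suc (x k)\<close>; any other prescribed value leaves the empty event.\<close>
  define next_event where "next_event =
    (if x (Suc k) = 0 then (\<Union>m. R m)
     else if x (Suc k) = Suc (x k) then (\<Union>m. A m) - (\<Union>m. R m) else {})"
  have "AE \<omega> in M. \<omega> \<in> {\<omega> \<in> space M. X (Suc k) \<omega> = x (Suc k) \<and> ?Y \<omega>} \<longleftrightarrow> \<omega> \<in> next_event"
    using AE_success AE_space
  proof eventually_elim
    case (elim \<omega>)
    have in_A: "\<omega> \<in> (\<Union>m. A m) \<longleftrightarrow> ?Y \<omega>"
      unfolding A_def using elim by (simp add: X first_and_gaps_iff)
    have in_R: "\<omega> \<in> (\<Union>m. R m) \<longleftrightarrow> ?Y \<omega> \<and> D (Suc (first_success \<omega> + k)) \<omega>"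
      unfolding R_def using elim by (simp add: X first_and_gaps_iff)
    have "X (Suc k) \<omega> = (if D (Suc (first_success \<omega> + k)) \<omega> then 0 else Suc (X k \<omega>))"
      using elim by (simp add: X)
    then show ?case
      unfolding next_event_def using in_A in_R elim by auto
  qed
  then have "prob {\<omega> \<in> space M. X (Suc k) \<omega> = x (Suc k) \<and> ?Y \<omega>} = prob next_event"
    using A_events R_events by (intro measure_eq_AE) (auto simp: next_event_def)
  also have "\<dots> = pmf (reset_kernel p (x k)) (x (Suc k)) * prob (\<Union>m. A m)"
    using p_pos p_less_1 unfolding next_event_def
    by (auto simp: pmf_reset_kernel prob_R prob_diff)
  finally show "cond_prob M (\<lambda>\<omega>. X (Suc k) \<omega> = x (Suc k)) ?Y = pmf (reset_kernel p (x k)) (x (Suc k))"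
    using ne unfolding cond_prob_def prob_A by simp
qed

text \<open>The path that only increases reaches every state, so it determines the whole kernel.\<close>

lemma markov_chain_kernel_unique:
  assumes X: "\<And>k \<omega>. \<exists>m. D m \<omega> \<Longrightarrow> X k \<omega> = gap (\<lambda>m. D m \<omega>) (first_success \<omega> + k)"
    and K: "markov_chain M X K" and K': "markov_chain M X K'"
  shows "K = K'"
proof (intro ext pmf_eqI)
  fix k y :: nat
  have meas [measurable]: "X j \<in> measurable M (count_space UNIV)" for j
    using K unfolding markov_chain_def by blast
  \<comment> \<open>The path climbs from 0 to \<open>k\<close> and then steps to the state
    \<open>y\<close> under test.\<close>
  define x where "x j = (if j \<le> k then j else y)" for j
  have "0 < (1 - p) ^ k * p"
    using p_pos p_less_1 by simp
  also have "\<dots> = prob {\<omega> \<in> space M. D 0 \<omega> \<and> (\<forall>j<k. \<not> D (Suc (0 + j)) \<omega>)}"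
    using prob_failures_after[of 0 "\<lambda>d. d 0" k] by (simp add: depends_upto_def prob_success)
  \<comment> \<open>A success in slot 0 makes the time shift zero, and \<open>k\<close> failures
    after it force the climbing path.\<close>
  also have "\<dots> \<le> prob {\<omega> \<in> space M. \<forall>j\<le>k. X j \<omega> = x j}"
  proof (intro finite_measure_mono subsetI CollectI conjI)
    fix \<omega> assume "\<omega> \<in> {\<omega> \<in> space M. D 0 \<omega> \<and> (\<forall>j<k. \<not> D (Suc (0 + j)) \<omega>)}"
    then have \<omega>: "\<omega> \<in> space M" "D 0 \<omega>" "\<And>j. j < k \<Longrightarrow> \<not> D (Suc j) \<omega>"
      by auto
    show "\<omega> \<in> space M"
      by fact
    have T: "first_success \<omega> = 0"
      unfolding first_success_def using \<omega>(2) by simp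
    show "\<forall>j\<le>k. X j \<omega> = x j"
    proof (intro allI impI)
      fix j assume "j \<le> k"
      have "\<not> D i \<omega>" if "0 < i" "i \<le> j" for i
        using \<omega>(3)[of "i - 1"] that \<open>j \<le> k\<close> by simp
      then have "gap (\<lambda>m. D m \<omega>) j = j"
        by (rule gap_no_success)
      then show "X j \<omega> = x j"
        using X[of \<omega> j] \<omega>(2) \<open>j \<le> k\<close> unfolding T x_def by auto
    qed
  qed measurable
  finally have ne: "prob {\<omega> \<in> space M. \<forall>j\<le>k. X j \<omega> = x j} \<noteq> 0"
    by simp
  have kernel: "pmf (L (x k)) (x (Suc k)) =
      \<P>(\<omega> in M. X (Suc k) \<omega> = x (Suc k) \<bar> \<forall>j\<le>k. X j \<omega> = x j)"
    if "markov_chain M X L" for L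
    using that[unfolded markov_chain_def, THEN conjunct2, THEN spec[of _ k], THEN spec[of _ x],
        THEN mp, OF ne] by (rule sym)
  have "pmf (K (x k)) (x (Suc k)) = pmf (K' (x k)) (x (Suc k))"
    unfolding kernel[OF K] kernel[OF K'] ..
  then show "pmf (K k) y = pmf (K' k) y"
    by (simp add: x_def)
qed

text \<open>Existence and uniqueness of the kernel reduce the quantifier over \<open>K\<close> to
  \<open>reset_kernel p\<close>, leaving its fixed-point equation.\<close>

lemma stationary_distribution_iff:
  assumes meas: "\<And>k. X k \<in> measurable M (count_space UNIV)"
    and X: "\<And>k \<omega>. \<exists>m. D m \<omega> \<Longrightarrow> X k \<omega> = gap (\<lambda>m. D m \<omega>) (first_success \<omega> + k)"
  shows "stationary_distribution M X \<pi> \<longleftrightarrow> \<pi> = geometric_pmf p"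
proof -
  have chain: "markov_chain M X (reset_kernel p)"
    using meas X by (rule markov_chain_reset_kernel)
  have "K = reset_kernel p" if "markov_chain M X K" for K
    using X that chain by (rule markov_chain_kernel_unique)
  with chain have "markov_chain M X K \<longleftrightarrow> K = reset_kernel p" for K
    by metis
  then show ?thesis
    unfolding stationary_distribution_def
    using bind_reset_kernel_fixed_iff[OF p_pos p_less_1] by simp
qed

end

section \<open>Slotted ALOHA\<close>

text \<open>Delivery in slot \<open>k\<close> is a function of the activities in that slot, and
  different slots use disjoint blocks of an independent family. Within a slot, independence over
  nodes gives one factor \<open>\<rho>\<close> and \<open>n - 1\<close> factors
  \<open>1 - \<rho>\<close>.\<close>

lemma bernoulli_process_delivers:
  fixes M :: "'a measure" and n :: nat and \<rho> :: real and act :: "nat \<Rightarrow> nat \<Rightarrow> 'a \<Rightarrow> bool"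
  assumes M: "prob_space M"
    and \<rho>: "0 < \<rho>" "\<rho> < 1"
    and ind: "prob_space.indep_vars M (\<lambda>_. count_space UNIV) (\<lambda>(i, k). act i k) ({1..n} \<times> UNIV)"
    and prob: "\<And>i k. i \<in> {1..n} \<Longrightarrow> \<P>(\<omega> in M. act i k \<omega>) = \<rho>"
    and i: "i \<in> {1..n}"
  shows "bernoulli_process M (delivers n act i) (xi_sa n \<rho>)"
proof -
  interpret prob_space M
    by (rule M)
  let ?X = "\<lambda>(i, k). act i k"
  have act_meas [measurable]: "act j k \<in> measurable M (count_space UNIV)" if "j \<in> {1..n}" for j k
    using ind that unfolding indep_vars_def by auto
  define S where "S k = (\<lambda>j. (j, k)) ` {1..n}" for k :: nat
  have blocks: "indep_vars (\<lambda>k. PiM (S k) (\<lambda>_. count_space UNIV)) (\<lambda>k \<omega>. restrict (\<lambda>jk. ?X jk \<omega>) (S k)) UNIV"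
    by (rule indep_vars_restrict[OF ind]) (auto simp: S_def disjoint_family_on_def)
  define g where "g k v \<longleftrightarrow> v (i, k) \<and> (\<forall>j\<in>{1..n}. j \<noteq> i \<longrightarrow> \<not> v (j, k))"
    for k and v :: "nat \<times> nat \<Rightarrow> bool"
  \<comment> \<open>A finite product of discrete Boolean spaces is discrete, so every function on it
    is measurable.\<close>
  have g_meas: "g k \<in> measurable (PiM (S k) (\<lambda>_. count_space UNIV)) (count_space UNIV)" for k
  proof -
    have "PiM (S k) (\<lambda>_. count_space UNIV) = count_space (PiE (S k) (\<lambda>_. UNIV :: bool set))"
      unfolding S_def by (intro count_space_PiM_finite) auto
    then show ?thesis
      by simp
  qed
  have delivers_eq: "delivers n act i = (\<lambda>k \<omega>. g k (restrict (\<lambda>jk. ?X jk \<omega>) (S k)))"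
    using i unfolding g_def S_def by (intro ext) (auto simp: delivers_def)
  have "indep_vars (\<lambda>_. count_space UNIV) (delivers n act i) UNIV"
    unfolding delivers_eq by (rule indep_vars_compose2[OF blocks g_meas])
  moreover have "prob {\<omega> \<in> space M. delivers n act i k \<omega>} = xi_sa n \<rho>" for k
  proof -
    have compl: "prob {\<omega> \<in> space M. \<not> act j k \<omega>} = 1 - \<rho>" if "j \<in> {1..n}" for j
      using prob_neg[of "act j k"] act_meas[OF that, of k] prob[OF that, of k] by simp
    have "delivers n act i k \<omega> \<longleftrightarrow> (\<forall>j\<in>{1..n}. act j k \<omega> = (j = i))" for \<omega>
      using i unfolding delivers_def by blast
    then have "{\<omega> \<in> space M. delivers n act i k \<omega>} = (\<Inter>j\<in>{1..n}. act j k -` {j = i} \<inter> space M)"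
      using i by auto
    then have "prob {\<omega> \<in> space M. delivers n act i k \<omega>} =
        prob (\<Inter>jk\<in>S k. ?X jk -` {fst jk = i} \<inter> space M)"
      by (simp add: S_def)
    also have "\<dots> = (\<Prod>jk\<in>S k. prob (?X jk -` {fst jk = i} \<inter> space M))"
      using i by (intro indep_varsD[OF ind]) (auto simp: S_def)
    also have "\<dots> = (\<Prod>j\<in>{1..n}. prob (act j k -` {j = i} \<inter> space M))"
      unfolding S_def by (subst prod.reindex) (auto simp: inj_on_def)
    also have "\<dots> = (\<Prod>j\<in>{1..n}. if j = i then \<rho> else 1 - \<rho>)"
    proof (intro prod.cong refl)
      fix j assume j: "j \<in> {1..n}"
      have "act j k -` {j = i} \<inter> space M =
          (if j = i then {\<omega> \<in> space M. act j k \<omega>} else {\<omega> \<in> space M. \<not> act j k \<omega>})"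
        by auto
      then show "prob (act j k -` {j = i} \<inter> space M) = (if j = i then \<rho> else 1 - \<rho>)"
        using prob[OF j, of k] compl[OF j] by (cases "j = i") simp_all
    qed
    also have "\<dots> = \<rho> * (\<Prod>j\<in>{1..n} - {i}. 1 - \<rho>)"
      using i by (subst prod.remove[of _ i]) (auto intro!: prod.cong)
    also have "\<dots> = xi_sa n \<rho>"
      using i by (simp add: xi_sa_def)
    finally show ?thesis .
  qed
  moreover have "0 < xi_sa n \<rho>"
    using \<rho> unfolding xi_sa_def by simp
  moreover have "xi_sa n \<rho> \<le> \<rho> * 1"
    using \<rho> unfolding xi_sa_def by (intro mult_left_mono power_le_one) auto
  ultimately show ?thesis
    using \<rho> M by (simp add: bernoulli_process_def bernoulli_process_axioms_def)
qed

text \<open>\<open>markov_chain\<close> asks for measurability on the whole space, including the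
  null event without deliveries. There the age is computed from \<open>Max {}\<close>, an
  unspecified value but constant in \<open>\<omega>\<close>.\<close>

lemma measurable_age_chain:
  assumes "bernoulli_process M (delivers n act i) p"
  shows "age_chain n act i k \<in> measurable M (count_space UNIV)"
proof -
  interpret bernoulli_process M "delivers n act i" p
    by fact
  have "(\<lambda>\<omega>. gap (\<lambda>m. delivers n act i m \<omega>) (first_success \<omega> + k)) \<in> measurable M (count_space UNIV)"
    by (rule measurable_compose_countable[where g = "\<lambda>\<omega>. first_success \<omega> + k"]) measurable
  then have "(\<lambda>\<omega>. if \<exists>m. delivers n act i m \<omega> then gap (\<lambda>m. delivers n act i m \<omega>) (first_success \<omega> + k)
      else nat \<lfloor>real k - Max {} - 1\<rfloor>) \<in> measurable M (count_space UNIV)"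
    by measurable
  also have "(\<lambda>\<omega>. if \<exists>m. delivers n act i m \<omega> then gap (\<lambda>m. delivers n act i m \<omega>) (first_success \<omega> + k)
      else nat \<lfloor>real k - Max {} - 1\<rfloor>) = age_chain n act i k"
  proof
    fix \<omega>
    show "(if \<exists>m. delivers n act i m \<omega> then gap (\<lambda>m. delivers n act i m \<omega>) (first_success \<omega> + k)
        else nat \<lfloor>real k - Max {} - 1\<rfloor>) = age_chain n act i k \<omega>"
    proof (cases "\<exists>m. delivers n act i m \<omega>")
      case True
      then show ?thesis
        by (simp only: if_True age_chain_eq first_success_def)
    next
      case False
      then show ?thesis
        by (simp add: age_chain_def age_def last_stamp_def)
    qed
  qed
  finally show ?thesis .
qed

theorem proposition4:
  fixes M :: "'a measure" and n :: nat and \<rho> :: real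
    and act :: "nat \<Rightarrow> nat \<Rightarrow> 'a \<Rightarrow> bool"
  assumes "prob_space M"
    and "n \<ge> 1"
    and "0 < \<rho>" and "\<rho> < 1"
    and "prob_space.indep_vars M (\<lambda>_. count_space UNIV) (\<lambda>(i, k). act i k) ({1..n} \<times> UNIV)"
    and "\<And>i k. i \<in> {1..n} \<Longrightarrow> \<P>(\<omega> in M. act i k \<omega>) = \<rho>"
  shows "(AE \<omega> in M.
            (\<forall>i\<in>{1..n}. \<exists>L. (time_avg_age n act i \<omega> \<longlongrightarrow> L) at_top) \<and>
            network_age n act \<omega> = 1 / 2 + real n / throughput_sa n \<rho>) \<and>
         (\<forall>i\<in>{1..n}.
            (\<exists>!\<pi>. stationary_distribution M (age_chain n act i) \<pi>) \<and>
            (\<forall>\<theta>::int. age_violation_prob M n act i \<theta> =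
               (if \<theta> > 1 then (1 - xi_sa n \<rho>) ^ nat (\<theta> - 1) else 1)))"
proof -
  have process: "bernoulli_process M (delivers n act i) (xi_sa n \<rho>)" if "i \<in> {1..n}" for i
    by (rule bernoulli_process_delivers[OF assms(1,3,4,5,6) that])
  have xi: "0 < xi_sa n \<rho>" "xi_sa n \<rho> < 1"
    using bernoulli_process.p_pos[OF process[of 1]] bernoulli_process.p_less_1[OF process[of 1]] assms(2)
    by simp_all
  define L where "L = (1 - xi_sa n \<rho>) / xi_sa n \<rho> + 3 / 2"
  \<comment> \<open>Both sides equal \<open>1 / xi_sa n \<rho> + 1 / 2\<close>.\<close>
  have L: "L = 1 / 2 + real n / throughput_sa n \<rho>"
  proof -
    have "throughput_sa n \<rho> = real n * xi_sa n \<rho>"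
      by (simp add: throughput_sa_def xi_sa_def)
    then show ?thesis
      using xi assms(2) unfolding L_def by (simp add: field_simps)
  qed
  have "AE \<omega> in M. (time_avg_age n act i \<omega> \<longlongrightarrow> L) at_top" if "i \<in> {1..n}" for i
  proof -
    interpret bernoulli_process M "delivers n act i" "xi_sa n \<rho>"
      by (rule process[OF that])
    show ?thesis
      using AE_success AE_gap_average
      by eventually_elim (auto simp: L_def intro!: time_avg_age_tendsto)
  qed
  \<comment> \<open>There are finitely many nodes, so one null set serves them all.\<close>
  then have "AE \<omega> in M. \<forall>i\<in>{1..n}. (time_avg_age n act i \<omega> \<longlongrightarrow> L) at_top"
    by (intro AE_finite_allI) auto
  then have "AE \<omega> in M. (\<forall>i\<in>{1..n}. \<exists>L. (time_avg_age n act i \<omega> \<longlongrightarrow> L) at_top) \<and>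
      network_age n act \<omega> = 1 / 2 + real n / throughput_sa n \<rho>"
  proof eventually_elim
    case (elim \<omega>)
    have "Lim at_top (time_avg_age n act i \<omega>) = L" if "i \<in> {1..n}" for i
      using elim that by (intro tendsto_Lim) auto
    then have "network_age n act \<omega> = L"
      using assms(2) by (simp add: network_age_def)
    then show ?case
      using elim L by auto
  qed
  moreover have "(\<exists>!\<pi>. stationary_distribution M (age_chain n act i) \<pi>) \<and>
      (\<forall>\<theta>::int. age_violation_prob M n act i \<theta> =
        (if \<theta> > 1 then (1 - xi_sa n \<rho>) ^ nat (\<theta> - 1) else 1))" if "i \<in> {1..n}" for i
  proof -
    interpret bernoulli_process M "delivers n act i" "xi_sa n \<rho>"
      by (rule process[OF that])
    have stat: "stationary_distribution M (age_chain n act i) \<pi> \<longleftrightarrow> \<pi> = geometric_pmf (xi_sa n \<rho>)" for \<pi>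
      by (rule stationary_distribution_iff)
         (simp_all add: measurable_age_chain[OF process[OF that]] age_chain_eq first_success_def)
    have "age_violation_prob M n act i \<theta> = (if \<theta> > 1 then (1 - xi_sa n \<rho>) ^ nat (\<theta> - 1) else 1)" for \<theta> :: int
    proof (cases "\<theta> > 1")
      case True
      \<comment> \<open>For integers, exceeding \<open>\<theta> - 2\<close> means being at least
        \<open>\<theta> - 1\<close>, which is positive here.\<close>
      then have "{\<psi>. int \<psi> > \<theta> - 2} = {nat (\<theta> - 1)..}"
        by auto
      then show ?thesis
        using True xi by (simp add: age_violation_prob_def stat prob_geometric_pmf_atLeast)
    next
      case False
      then have "{\<psi>. int \<psi> > \<theta> - 2} = UNIV"
        by auto
      then show ?thesis
        using False by (simp add: age_violation_prob_def stat)
    qed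
    then show ?thesis
      by (simp add: stat)
  qed
  ultimately show ?thesis
    by blast
qed

end
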